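(* Suppose that existence and uniqueness of strong solutions for the system (S) holds true, that $H$ is of class $C^2$, and that the system (S) has the passive local supermartingale property with respect to the storage function $H$. Moreover, suppose that $H$ is bounded from below and that for all $x_0\in\mathbb{R}^d$, all $u\in\mathcal{A}$ and all $t\in\mathbb{R}_+$ it holds that $$\mathbb{E}\Big[\int_0^t|\langle u_s,Y_s\rangle|\,ds\Big]<\infty,$$ where $Y_s=f(X_s,u_s)$, $s\ge0$, with $X=X^{(x_0,u)}$. Then the system (S) has the passive supermartingale property with respect to the storage function $H$.
   Context: Let $d,n,k\in\mathbb{N}$, $\mathbb{R}_+=[0,\infty)$, and let $(\Omega,\mathscr{F},(\mathscr{F}_t)_{t\ge0},\mathbb{P})$ be a filtered probability space satisfying the usual conditions, carrying an $\mathbb{R}^k$-valued Wiener process $W$. Let $\mathcal{A}$ be a set of $\mathbb{R}^n$-valued progressively measurable processes (the controls), let $b:\mathbb{R}^d\times\mathbb{R}^n\to\mathbb{R}^d$, $\sigma:\mathbb{R}^d\times\mathbb{R}^n\to\mathbb{R}^{d\times k}$, $f:\mathbb{R}^d\times\mathbb{R}^n\to\mathbb{R}^n$ be measurable, and let $H:\mathbb{R}^d\to\mathbb{R}$ be measurable (the storage function). The system (S) is $$dX_t=b(X_t,u_t)\,dt+\sigma(X_t,u_t)\,dW_t,\quad Y_t=f(X_t,u_t),\quad X_0=x_0\in\mathbb{R}^d,\quad u\in\mathcal{A}.$$ Strong solution: for $x_0\in\mathbb{R}^d$, $u\in\mathcal{A}$, a strong solution is an adapted continuous process $X$ such that $\mathbb{P}$-a.s.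 $\int_0^t(\|b(X_s,u_s)\|+\|\sigma(X_s,u_s)\|^2)ds<\infty$ and $X_t=x_0+\int_0^tb(X_s,u_s)ds+\int_0^t\sigma(X_s,u_s)dW_s$ for all $t\in\mathbb{R}_+$ (Euclidean and Frobenius norms). "Existence and uniqueness of strong solutions holds true" means that for all $x_0\in\mathbb{R}^d$, $u\in\mathcal{A}$ a strong solution exists and any two are indistinguishable; it is denoted $X^{(x_0,u)}$, and $Y^{(x_0,u)}:=f(X^{(x_0,u)},u)$. Define $Z_t^{(x_0,u)}:=H(X_t^{(x_0,u)})-\int_0^t\langle u_s,Y_s^{(x_0,u)}\rangle ds$, $t\in\mathbb{R}_+$. The system (S) has the passive supermartingale property (resp. passive local supermartingale property) with respect to $H$ if for all $x_0\in\mathbb{R}^d$ and $u\in\mathcal{A}$ the process $Z^{(x_0,u)}$ is a supermartingale (resp. a local supermartingale). *)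

theory Defs
  imports "HOL-Probability.Probability"
begin

text \<open>
  Time is the half line \<open>[0, \<infinity>)\<close>. Processes and filtrations are indexed by \<^typ>\<open>real\<close>, and
  every condition below only concerns indices \<open>t \<ge> 0\<close>. Vectors live in \<^typ>\<open>real ^ 'n\<close>;
  a \<open>d \<times> k\<close> matrix is an element of \<^typ>\<open>real ^ 'k ^ 'd\<close>, whose library norm is the Frobenius
  norm.
\<close>

section \<open>Filtered probability spaces and processes\<close>

definition filtered_prob_space :: "'a measure \<Rightarrow> (real \<Rightarrow> 'a measure) \<Rightarrow> bool" where
  "filtered_prob_space M F \<longleftrightarrow>
     prob_space M \<and>
     (\<forall>t\<ge>0. subalgebra M (F t)) \<and>
     (\<forall>s\<ge>0. \<forall>t\<ge>s. sets (F s) \<subseteq> sets (F t))"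

definition usual_conditions :: "'a measure \<Rightarrow> (real \<Rightarrow> 'a measure) \<Rightarrow> bool" where
  "usual_conditions M F \<longleftrightarrow>
     complete_measure M \<and>
     null_sets M \<subseteq> sets (F 0) \<and>
     (\<forall>t\<ge>0. (\<Inter>s\<in>{t<..}. sets (F s)) = sets (F t))"

definition adapted :: "(real \<Rightarrow> 'a measure) \<Rightarrow> (real \<Rightarrow> 'a \<Rightarrow> 'b::topological_space) \<Rightarrow> bool" where
  "adapted F X \<longleftrightarrow> (\<forall>t\<ge>0. X t \<in> borel_measurable (F t))"

definition progressively_measurable ::
    "(real \<Rightarrow> 'a measure) \<Rightarrow> (real \<Rightarrow> 'a \<Rightarrow> 'b::topological_space) \<Rightarrow> bool" where
  "progressively_measurable F X \<longleftrightarrow>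
     (\<forall>t\<ge>0. (\<lambda>(s, \<omega>). X s \<omega>) \<in> borel_measurable (restrict_space borel {0..t} \<Otimes>\<^sub>M F t))"

definition continuous_paths :: "'a measure \<Rightarrow> (real \<Rightarrow> 'a \<Rightarrow> 'b::topological_space) \<Rightarrow> bool" where
  "continuous_paths M X \<longleftrightarrow> (\<forall>\<omega>\<in>space M. continuous_on {0..} (\<lambda>t. X t \<omega>))"

definition indistinguishable ::
    "'a measure \<Rightarrow> (real \<Rightarrow> 'a \<Rightarrow> 'b) \<Rightarrow> (real \<Rightarrow> 'a \<Rightarrow> 'b) \<Rightarrow> bool" where
  "indistinguishable M X X' \<longleftrightarrow> (AE \<omega> in M. \<forall>t\<ge>0. X t \<omega> = X' t \<omega>)"

definition wiener_process ::
    "'a measure \<Rightarrow> (real \<Rightarrow> 'a measure) \<Rightarrow> (real \<Rightarrow> 'a \<Rightarrow> real ^ 'k) \<Rightarrow> bool" where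
  "wiener_process M F W \<longleftrightarrow>
     adapted F W \<and>
     continuous_paths M W \<and>
     (AE \<omega> in M. W 0 \<omega> = 0) \<and>
     (\<forall>s\<ge>0. \<forall>t>s.
        prob_space.indep_set M (sets (F s))
          (sets (vimage_algebra (space M) (\<lambda>\<omega>. W t \<omega> - W s \<omega>) borel)) \<and>
        prob_space.indep_vars M (\<lambda>_. borel) (\<lambda>i \<omega>. (W t \<omega> - W s \<omega>) $ i) UNIV \<and>
        (\<forall>i. distributed M lborel (\<lambda>\<omega>. (W t \<omega> - W s \<omega>) $ i)
               (normal_density 0 (sqrt (t - s)))))"

section \<open>Supermartingales and local supermartingales\<close>

definition supermartingale ::
    "'a measure \<Rightarrow> (real \<Rightarrow> 'a measure) \<Rightarrow> (real \<Rightarrow> 'a \<Rightarrow> real) \<Rightarrow> bool" where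
  "supermartingale M F Z \<longleftrightarrow>
     adapted F Z \<and>
     (\<forall>t\<ge>0. integrable M (Z t)) \<and>
     (\<forall>s\<ge>0. \<forall>t\<ge>s. AE \<omega> in M. real_cond_exp M (F s) (Z t) \<omega> \<le> Z s \<omega>)"

text \<open>
  Stopping times take values in \<open>[0, \<infinity>]\<close> while the filtration is indexed by \<open>[0, \<infinity>)\<close>; the
  library's \<^const>\<open>stopping_time\<close> requires the two types to agree.
\<close>

definition extended_stopping_time ::
    "'a measure \<Rightarrow> (real \<Rightarrow> 'a measure) \<Rightarrow> ('a \<Rightarrow> ennreal) \<Rightarrow> bool" where
  "extended_stopping_time M F \<tau> \<longleftrightarrow> (\<forall>t\<ge>0. {\<omega> \<in> space M. \<tau> \<omega> \<le> ennreal t} \<in> sets (F t))"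

definition stopped_process ::
    "(real \<Rightarrow> 'a \<Rightarrow> 'b) \<Rightarrow> ('a \<Rightarrow> ennreal) \<Rightarrow> real \<Rightarrow> 'a \<Rightarrow> 'b" where
  "stopped_process Z \<tau> t \<omega> = Z (enn2real (min (ennreal t) (\<tau> \<omega>))) \<omega>"

definition local_supermartingale ::
    "'a measure \<Rightarrow> (real \<Rightarrow> 'a measure) \<Rightarrow> (real \<Rightarrow> 'a \<Rightarrow> real) \<Rightarrow> bool" where
  "local_supermartingale M F Z \<longleftrightarrow>
     adapted F Z \<and>
     (\<exists>\<tau> :: nat \<Rightarrow> 'a \<Rightarrow> ennreal.
        (\<forall>j. extended_stopping_time M F (\<tau> j)) \<and>
        (AE \<omega> in M. incseq (\<lambda>j. \<tau> j \<omega>) \<and> (\<lambda>j. \<tau> j \<omega>) \<longlonglongrightarrow> \<infinity>) \<and>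
        (\<forall>j. supermartingale M F (stopped_process Z (\<tau> j))))"

section \<open>The Ito integral\<close>

text \<open>
  A simple integrand is \<open>\<Sum>i<m. \<xi> i * 1_(p i, p (i+1)]\<close> with bounded, \<open>F (p i)\<close>-measurable
  matrix-valued coefficients \<open>\<xi> i\<close>.
\<close>

definition simple_integrand ::
    "'a measure \<Rightarrow> (real \<Rightarrow> 'a measure) \<Rightarrow> nat \<Rightarrow> (nat \<Rightarrow> real) \<Rightarrow>
     (nat \<Rightarrow> 'a \<Rightarrow> real ^ 'k ^ 'd) \<Rightarrow> bool" where
  "simple_integrand M F m p \<xi> \<longleftrightarrow>
     0 \<le> p 0 \<and> mono_on {..m} p \<and>
     (\<forall>i<m. \<xi> i \<in> borel_measurable (F (p i)) \<and> bounded (\<xi> i ` space M))"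

definition simple_process ::
    "nat \<Rightarrow> (nat \<Rightarrow> real) \<Rightarrow> (nat \<Rightarrow> 'a \<Rightarrow> real ^ 'k ^ 'd) \<Rightarrow> real \<Rightarrow> 'a \<Rightarrow> real ^ 'k ^ 'd" where
  "simple_process m p \<xi> s \<omega> = (\<Sum>i<m. indicat_real {p i<..p (Suc i)} s *\<^sub>R \<xi> i \<omega>)"

definition simple_ito_integral ::
    "(real \<Rightarrow> 'a \<Rightarrow> real ^ 'k) \<Rightarrow> nat \<Rightarrow> (nat \<Rightarrow> real) \<Rightarrow> (nat \<Rightarrow> 'a \<Rightarrow> real ^ 'k ^ 'd) \<Rightarrow>
     real \<Rightarrow> 'a \<Rightarrow> real ^ 'd" where
  "simple_ito_integral W m p \<xi> t \<omega> =
     (\<Sum>i<m. \<xi> i \<omega> *v (W (min t (p (Suc i))) \<omega> - W (min t (p i)) \<omega>))"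

text \<open>
  \<open>I\<close> is (a version of) the process \<open>\<integral>\<^sub>0\<^sup>t \<phi>\<^sub>s dW\<^sub>s\<close>: there are simple integrands \<open>\<phi>\<^sup>j\<close> with
  \<open>\<integral>\<^sub>0\<^sup>t \<parallel>\<phi>\<^sub>s - \<phi>\<^sup>j\<^sub>s\<parallel>\<^sup>2 ds \<rightarrow> 0\<close> in probability for every \<open>t\<close>, whose elementary integrals converge to
  \<open>I\<close> in probability uniformly on compact time intervals. This is the usual extension of the
  integral to progressively measurable \<open>\<phi>\<close> with \<open>\<integral>\<^sub>0\<^sup>t \<parallel>\<phi>\<^sub>s\<parallel>\<^sup>2 ds < \<infinity>\<close> almost surely; it determines
  \<open>I\<close> up to indistinguishability. The requirements on \<open>\<phi>\<close> and \<open>I\<close> make the events below measurable.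
\<close>

definition is_ito_integral ::
    "'a measure \<Rightarrow> (real \<Rightarrow> 'a measure) \<Rightarrow> (real \<Rightarrow> 'a \<Rightarrow> real ^ 'k) \<Rightarrow>
     (real \<Rightarrow> 'a \<Rightarrow> real ^ 'k ^ 'd) \<Rightarrow> (real \<Rightarrow> 'a \<Rightarrow> real ^ 'd) \<Rightarrow> bool" where
  "is_ito_integral M F W \<phi> I \<longleftrightarrow>
     progressively_measurable F \<phi> \<and> adapted F I \<and> continuous_paths M I \<and>
     (\<exists>m p \<xi>.
        (\<forall>j. simple_integrand M F (m j) (p j) (\<xi> j)) \<and>
        (\<forall>t\<ge>0. \<forall>\<epsilon>>0.
           (\<lambda>j::nat. measure M {\<omega> \<in> space M.
              (\<integral>\<^sup>+s\<in>{0..t}. ennreal ((norm (\<phi> s \<omega> - simple_process (m j) (p j) (\<xi> j) s \<omega>))\<^sup>2) \<partial>lborel)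
                > ennreal \<epsilon>}) \<longlonglongrightarrow> 0 \<and>
           (\<lambda>j. measure M {\<omega> \<in> space M.
              \<exists>s\<in>{0..t}. norm (I s \<omega> - simple_ito_integral W (m j) (p j) (\<xi> j) s \<omega>) > \<epsilon>})
             \<longlonglongrightarrow> 0))"

section \<open>The controlled system\<close>

definition strong_solution ::
    "'a measure \<Rightarrow> (real \<Rightarrow> 'a measure) \<Rightarrow> (real \<Rightarrow> 'a \<Rightarrow> real ^ 'k) \<Rightarrow>
     ((real ^ 'd) \<times> (real ^ 'n) \<Rightarrow> real ^ 'd) \<Rightarrow> ((real ^ 'd) \<times> (real ^ 'n) \<Rightarrow> real ^ 'k ^ 'd) \<Rightarrow>
     real ^ 'd \<Rightarrow> (real \<Rightarrow> 'a \<Rightarrow> real ^ 'n) \<Rightarrow> (real \<Rightarrow> 'a \<Rightarrow> real ^ 'd) \<Rightarrow> bool" where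
  "strong_solution M F W b \<sigma> x\<^sub>0 u X \<longleftrightarrow>
     adapted F X \<and> continuous_paths M X \<and>
     (AE \<omega> in M. \<forall>t\<ge>0.
        (\<integral>\<^sup>+s\<in>{0..t}. ennreal (norm (b (X s \<omega>, u s \<omega>)) + (norm (\<sigma> (X s \<omega>, u s \<omega>)))\<^sup>2) \<partial>lborel)
          < \<infinity>) \<and>
     (\<exists>I. is_ito_integral M F W (\<lambda>s \<omega>. \<sigma> (X s \<omega>, u s \<omega>)) I \<and>
        (AE \<omega> in M. \<forall>t\<ge>0.
           X t \<omega> = x\<^sub>0 + (LINT s:{0..t}|lborel. b (X s \<omega>, u s \<omega>)) + I t \<omega>))"

definition existence_and_uniqueness ::
    "'a measure \<Rightarrow> (real \<Rightarrow> 'a measure) \<Rightarrow> (real \<Rightarrow> 'a \<Rightarrow> real ^ 'k) \<Rightarrow>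
     (real \<Rightarrow> 'a \<Rightarrow> real ^ 'n) set \<Rightarrow>
     ((real ^ 'd) \<times> (real ^ 'n) \<Rightarrow> real ^ 'd) \<Rightarrow> ((real ^ 'd) \<times> (real ^ 'n) \<Rightarrow> real ^ 'k ^ 'd) \<Rightarrow>
     bool" where
  "existence_and_uniqueness M F W A b \<sigma> \<longleftrightarrow>
     (\<forall>x\<^sub>0. \<forall>u\<in>A.
        (\<exists>X. strong_solution M F W b \<sigma> x\<^sub>0 u X) \<and>
        (\<forall>X X'. strong_solution M F W b \<sigma> x\<^sub>0 u X \<longrightarrow> strong_solution M F W b \<sigma> x\<^sub>0 u X' \<longrightarrow>
                indistinguishable M X X'))"

text \<open>
  A representative of the strong solution started at \<open>x\<^sub>0\<close> and driven by \<open>u\<close>; meaningful, and unique up to indistinguishability, under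
  \<^const>\<open>existence_and_uniqueness\<close>.
\<close>

definition solution ::
    "'a measure \<Rightarrow> (real \<Rightarrow> 'a measure) \<Rightarrow> (real \<Rightarrow> 'a \<Rightarrow> real ^ 'k) \<Rightarrow>
     ((real ^ 'd) \<times> (real ^ 'n) \<Rightarrow> real ^ 'd) \<Rightarrow> ((real ^ 'd) \<times> (real ^ 'n) \<Rightarrow> real ^ 'k ^ 'd) \<Rightarrow>
     real ^ 'd \<Rightarrow> (real \<Rightarrow> 'a \<Rightarrow> real ^ 'n) \<Rightarrow> real \<Rightarrow> 'a \<Rightarrow> real ^ 'd" where
  "solution M F W b \<sigma> x\<^sub>0 u = (SOME X. strong_solution M F W b \<sigma> x\<^sub>0 u X)"

definition system_output ::
    "((real ^ 'd) \<times> (real ^ 'n) \<Rightarrow> real ^ 'n) \<Rightarrow>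
     (real \<Rightarrow> 'a \<Rightarrow> real ^ 'd) \<Rightarrow> (real \<Rightarrow> 'a \<Rightarrow> real ^ 'n) \<Rightarrow> real \<Rightarrow> 'a \<Rightarrow> real ^ 'n" where
  "system_output f X u s \<omega> = f (X s \<omega>, u s \<omega>)"

text \<open>
  The pathwise Lebesgue integral is the library's, hence \<open>0\<close> where \<open>\<langle>u, Y\<rangle>\<close> is not integrable.
\<close>

definition passivity_process ::
    "(real ^ 'd \<Rightarrow> real) \<Rightarrow> (real \<Rightarrow> 'a \<Rightarrow> real ^ 'd) \<Rightarrow>
     (real \<Rightarrow> 'a \<Rightarrow> real ^ 'n) \<Rightarrow> (real \<Rightarrow> 'a \<Rightarrow> real ^ 'n) \<Rightarrow> real \<Rightarrow> 'a \<Rightarrow> real" where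
  "passivity_process H X u Y t \<omega> = H (X t \<omega>) - (LINT s:{0..t}|lborel. u s \<omega> \<bullet> Y s \<omega>)"

definition passive_supermartingale_property ::
    "'a measure \<Rightarrow> (real \<Rightarrow> 'a measure) \<Rightarrow> (real \<Rightarrow> 'a \<Rightarrow> real ^ 'k) \<Rightarrow>
     (real \<Rightarrow> 'a \<Rightarrow> real ^ 'n) set \<Rightarrow>
     ((real ^ 'd) \<times> (real ^ 'n) \<Rightarrow> real ^ 'd) \<Rightarrow> ((real ^ 'd) \<times> (real ^ 'n) \<Rightarrow> real ^ 'k ^ 'd) \<Rightarrow>
     ((real ^ 'd) \<times> (real ^ 'n) \<Rightarrow> real ^ 'n) \<Rightarrow> (real ^ 'd \<Rightarrow> real) \<Rightarrow> bool" where
  "passive_supermartingale_property M F W A b \<sigma> f H \<longleftrightarrow>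
     (\<forall>x\<^sub>0. \<forall>u\<in>A. let X = solution M F W b \<sigma> x\<^sub>0 u; Y = system_output f X u in
        supermartingale M F (passivity_process H X u Y))"

definition passive_local_supermartingale_property ::
    "'a measure \<Rightarrow> (real \<Rightarrow> 'a measure) \<Rightarrow> (real \<Rightarrow> 'a \<Rightarrow> real ^ 'k) \<Rightarrow>
     (real \<Rightarrow> 'a \<Rightarrow> real ^ 'n) set \<Rightarrow>
     ((real ^ 'd) \<times> (real ^ 'n) \<Rightarrow> real ^ 'd) \<Rightarrow> ((real ^ 'd) \<times> (real ^ 'n) \<Rightarrow> real ^ 'k ^ 'd) \<Rightarrow>
     ((real ^ 'd) \<times> (real ^ 'n) \<Rightarrow> real ^ 'n) \<Rightarrow> (real ^ 'd \<Rightarrow> real) \<Rightarrow> bool" where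
  "passive_local_supermartingale_property M F W A b \<sigma> f H \<longleftrightarrow>
     (\<forall>x\<^sub>0. \<forall>u\<in>A. let X = solution M F W b \<sigma> x\<^sub>0 u; Y = system_output f X u in
        local_supermartingale M F (passivity_process H X u Y))"

definition class_C2 :: "('v::real_normed_vector \<Rightarrow> real) \<Rightarrow> bool" where
  "class_C2 H \<longleftrightarrow>
     (\<exists>(H' :: 'v \<Rightarrow> 'v \<Rightarrow>\<^sub>L real) (H'' :: 'v \<Rightarrow> 'v \<Rightarrow>\<^sub>L ('v \<Rightarrow>\<^sub>L real)).
        (\<forall>x. (H has_derivative blinfun_apply (H' x)) (at x)) \<and>
        (\<forall>x. (H' has_derivative blinfun_apply (H'' x)) (at x)) \<and>
        continuous_on UNIV H'')"

end

theory Submission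
  imports Defs
begin

text \<open>
  Since \<open>H \<ge> c\<close>, on \<open>[0, t]\<close> the process \<open>Z\<close> is bounded below by the integrable random variable
  \<open>c - \<integral>\<^sub>0\<^sup>t \<bar>\<langle>u\<^sub>s, Y\<^sub>s\<rangle>\<bar> ds\<close>, so Fatou's lemma carries the supermartingale inequality from the
  localized processes to \<open>Z\<close>. Conditional Fatou is avoided by testing on events
  \<open>D \<inter> {\<tau>\<^sub>i > s}\<close> with \<open>D \<in> F\<^sub>s\<close>: there the stopped processes at time \<open>s\<close> agree with \<open>Z\<^sub>s\<close> from
  index \<open>i\<close> on. No path regularity of \<open>Z\<close> is used, because \<open>t \<and> \<tau>\<^sub>j = t\<close> for large \<open>j\<close>.
\<close>

section \<open>Fatou's lemma with an integrable lower bound\<close>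

text \<open>Fatou's lemma applies to the almost everywhere nonnegative functions
  \<open>f j - g\<close>. The uniform bound \<open>C\<close> on the integrals makes the integral of
  \<open>h - g\<close> finite, so integrability of the limit is part of the conclusion.\<close>

lemma integral_le_of_bounded_below_limit:
  fixes g :: "'a \<Rightarrow> real"
  assumes f_int: "\<And>j::nat. integrable M (f j)" and g_int: "integrable M g"
    and lower: "\<And>j. AE x in M. g x \<le> f j x"
    and lim: "AE x in M. (\<lambda>j. f j x) \<longlonglongrightarrow> h x"
    and h_meas: "h \<in> borel_measurable M"
    and bound: "\<And>j. integral\<^sup>L M (f j) \<le> C"
  shows "integrable M h" and "integral\<^sup>L M h \<le> C"
proof -
  have diff_le: "(\<integral>\<^sup>+x. ennreal (f j x - g x) \<partial>M) \<le> ennreal (C - integral\<^sup>L M g)" for j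
  proof -
    have "(\<integral>\<^sup>+x. ennreal (f j x - g x) \<partial>M) = ennreal (\<integral>x. f j x - g x \<partial>M)"
      using lower[of j] by (intro nn_integral_eq_integral) (auto simp: f_int g_int)
    also have "\<dots> = ennreal (integral\<^sup>L M (f j) - integral\<^sup>L M g)"
      by (simp add: f_int g_int)
    also have "\<dots> \<le> ennreal (C - integral\<^sup>L M g)"
      using bound[of j] by (intro ennreal_leI) simp
    finally show ?thesis .
  qed
  have "(\<integral>\<^sup>+x. ennreal (h x - g x) \<partial>M) = (\<integral>\<^sup>+x. liminf (\<lambda>j. ennreal (f j x - g x)) \<partial>M)"
  proof (rule nn_integral_cong_AE)
    show "AE x in M. ennreal (h x - g x) = liminf (\<lambda>j. ennreal (f j x - g x))"
      using lim
    proof eventually_elim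
      case (elim x)
      then have "(\<lambda>j. ennreal (f j x - g x)) \<longlonglongrightarrow> ennreal (h x - g x)"
        by (intro tendsto_intros)
      then show ?case
        by (simp add: lim_imp_Liminf)
    qed
  qed
  also have "\<dots> \<le> liminf (\<lambda>j. \<integral>\<^sup>+x. ennreal (f j x - g x) \<partial>M)"
    using f_int g_int by (intro nn_integral_liminf) auto
  also have "\<dots> \<le> ennreal (C - integral\<^sup>L M g)"
    by (rule Liminf_le) (auto simp: diff_le)
  finally have nn: "(\<integral>\<^sup>+x. ennreal (h x - g x) \<partial>M) \<le> ennreal (C - integral\<^sup>L M g)" .
  \<comment> \<open>The bound \<open>nn\<close> only sees the positive part of \<open>h - g\<close>,
    since \<open>ennreal\<close> sends negative numbers to 0. The sign of \<open>h - g\<close> is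
    therefore needed before integrability can be read off.\<close>
  have nonneg: "AE x in M. 0 \<le> h x - g x"
  proof -
    have "AE x in M. \<forall>j. g x \<le> f j x"
      using lower by (simp add: AE_all_countable)
    with lim show ?thesis
      by eventually_elim (auto intro: LIMSEQ_le_const)
  qed
  have int: "integrable M (\<lambda>x. h x - g x)"
    using h_meas g_int nonneg nn
    by (intro integrableI_nonneg) (auto intro: le_less_trans)
  from Bochner_Integration.integrable_add[OF this g_int] show h_int: "integrable M h"
    by simp
  \<comment> \<open>An inequality between \<open>ennreal\<close> values descends to the reals only
    if the right-hand side is nonnegative. The member \<open>f 0\<close> of the sequence shows this
    for \<open>C - integral g\<close>.\<close>
  have "integral\<^sup>L M g \<le> integral\<^sup>L M (f 0)"
    using lower by (intro integral_mono_AE f_int g_int)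
  then have "0 \<le> C - integral\<^sup>L M g"
    using bound[of 0] by simp
  moreover have "ennreal (\<integral>x. h x - g x \<partial>M) \<le> ennreal (C - integral\<^sup>L M g)"
    using nn nn_integral_eq_integral[OF int nonneg] by simp
  ultimately have "(\<integral>x. h x - g x \<partial>M) \<le> C - integral\<^sup>L M g"
    by simp
  then show "integral\<^sup>L M h \<le> C"
    by (simp add: h_int g_int)
qed

section \<open>From local supermartingales to supermartingales\<close>

lemma filtered_prob_space_finite_measure_subalgebra:
  assumes "filtered_prob_space M F" "0 \<le> t"
  shows "finite_measure_subalgebra M (F t)"
  using assms unfolding filtered_prob_space_def
  by (auto simp: finite_measure_subalgebra_def finite_measure_subalgebra_axioms_def
      prob_space_def)

text \<open>Conditioning on \<open>F s\<close> preserves integrals over events of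
  \<open>F s\<close>. The resulting integral form of the supermartingale inequality is the one that
  passes through Fatou's lemma.\<close>

lemma supermartingale_set_integral_mono:
  assumes filt: "filtered_prob_space M F" and Z: "supermartingale M F Z"
    and st: "0 \<le> s" "s \<le> t" and B: "B \<in> sets (F s)"
  shows "(\<integral>\<omega>\<in>B. Z t \<omega> \<partial>M) \<le> (\<integral>\<omega>\<in>B. Z s \<omega> \<partial>M)"
proof -
  interpret finite_measure_subalgebra M "F s"
    using filt st(1) by (rule filtered_prob_space_finite_measure_subalgebra)
  have BM: "B \<in> sets M"
    using B subalg by (auto simp: subalgebra_def)
  have int: "integrable M (Z s)" "integrable M (Z t)"
    using Z st by (auto simp: supermartingale_def)
  have "(\<integral>\<omega>\<in>B. Z t \<omega> \<partial>M) = (\<integral>\<omega>\<in>B. real_cond_exp M (F s) (Z t) \<omega> \<partial>M)"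
    using int(2) B by (rule real_cond_exp_intA)
  also have "\<dots> \<le> (\<integral>\<omega>\<in>B. Z s \<omega> \<partial>M)"
    unfolding set_lebesgue_integral_def
  proof (rule integral_mono_AE)
    show "integrable M (\<lambda>\<omega>. indicat_real B \<omega> *\<^sub>R real_cond_exp M (F s) (Z t) \<omega>)"
      "integrable M (\<lambda>\<omega>. indicat_real B \<omega> *\<^sub>R Z s \<omega>)"
      by (rule integrable_mult_indicator[OF BM real_cond_exp_int(1)[OF int(2)]])
        (rule integrable_mult_indicator[OF BM int(1)])
    have "AE \<omega> in M. real_cond_exp M (F s) (Z t) \<omega> \<le> Z s \<omega>"
      using Z st by (auto simp: supermartingale_def)
    then show "AE \<omega> in M. indicat_real B \<omega> *\<^sub>R real_cond_exp M (F s) (Z t) \<omega>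
        \<le> indicat_real B \<omega> *\<^sub>R Z s \<omega>"
      by eventually_elim (auto simp: indicator_def)
  qed
  finally show ?thesis .
qed

lemma stopped_process_before:
  assumes "0 \<le> t" "ennreal t \<le> \<tau> \<omega>"
  shows "stopped_process Z \<tau> t \<omega> = Z t \<omega>"
  using assms by (simp add: stopped_process_def min_absorb1)

text \<open>The stopped process at time \<open>t\<close> samples the path at some time in
  \<open>{0..t}\<close>. A lower bound for the path on this interval thus serves every localizing
  time at once.\<close>

lemma stopped_process_lower_bound:
  assumes "\<forall>s\<in>{0..t}. c \<le> Z s \<omega>" and "0 \<le> t"
  shows "c \<le> stopped_process Z \<tau> t \<omega>"
proof -
  have "enn2real (min (ennreal t) (\<tau> \<omega>)) \<le> enn2real (ennreal t)"
    by (intro enn2real_mono) auto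
  then have "enn2real (min (ennreal t) (\<tau> \<omega>)) \<in> {0..t}"
    using assms(2) by simp
  then show ?thesis
    using assms(1) unfolding stopped_process_def by blast
qed

text \<open>In \<open>lower\<close> the quantifier over \<open>s\<close> stands inside the almost
  sure statement because the path is evaluated at random times; a separate null set for each
  \<open>s\<close> would not control these values.\<close>

lemma local_supermartingale_bounded_below_imp_supermartingale:
  assumes filt: "filtered_prob_space M F" and Z: "local_supermartingale M F Z"
    and lower: "\<And>t. 0 \<le> t \<Longrightarrow>
      \<exists>g. integrable M g \<and> (AE \<omega> in M. \<forall>s\<in>{0..t}. g \<omega> \<le> Z s \<omega>)"
  shows "supermartingale M F Z"
proof -
  from Z obtain \<tau> :: "nat \<Rightarrow> 'a \<Rightarrow> ennreal" where
    adapted: "adapted F Z" and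
    stop: "\<And>j. extended_stopping_time M F (\<tau> j)" and
    \<tau>: "AE \<omega> in M. incseq (\<lambda>j. \<tau> j \<omega>) \<and> (\<lambda>j. \<tau> j \<omega>) \<longlonglongrightarrow> \<infinity>" and
    super: "\<And>j. supermartingale M F (stopped_process Z (\<tau> j))"
    unfolding local_supermartingale_def by blast
  have sub: "subalgebra M (F t)" if "0 \<le> t" for t
    using filt that by (simp add: filtered_prob_space_def)
  have meas: "Z t \<in> borel_measurable M" if "0 \<le> t" for t
    using adapted measurable_from_subalg[OF sub] that by (auto simp: adapted_def)
  have \<tau>_large: "AE \<omega> in M. \<forall>\<^sub>F j in sequentially. ennreal t < \<tau> j \<omega>" for t
    using \<tau> by eventually_elim (auto dest: order_tendstoD(1)[where a="ennreal t"])
  have lim: "AE \<omega> in M. (\<lambda>j. stopped_process Z (\<tau> j) t \<omega>) \<longlonglongrightarrow> Z t \<omega>" if "0 \<le> t" for t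
    using \<tau>_large[of t]
  proof eventually_elim
    case (elim \<omega>)
    then show ?case
      by (intro tendsto_eventually) (auto elim!: eventually_mono
          intro: stopped_process_before[OF that])
  qed
  \<comment> \<open>The shift by \<open>i\<close> lets the bound \<open>C\<close> be assumed only
    from index \<open>i\<close> on. It is used with \<open>i = 0\<close> for integrability and with
    the index of the test event for the inequality.\<close>
  have fatou: "integrable M (\<lambda>\<omega>. indicator B \<omega> *\<^sub>R Z t \<omega>)" "(\<integral>\<omega>\<in>B. Z t \<omega> \<partial>M) \<le> C"
    if t: "0 \<le> t" and B: "B \<in> sets M"
      and C: "\<And>j. (\<integral>\<omega>\<in>B. stopped_process Z (\<tau> (j + i)) t \<omega> \<partial>M) \<le> C" for t B C i
  proof -
    obtain g where g: "integrable M g" "AE \<omega> in M. \<forall>s\<in>{0..t}. g \<omega> \<le> Z s \<omega>"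
      using lower[OF t] by blast
    have int: "integrable M (\<lambda>\<omega>. indicat_real B \<omega> *\<^sub>R stopped_process Z (\<tau> (j + i)) t \<omega>)" for j
      using super t B by (intro integrable_mult_indicator) (auto simp: supermartingale_def)
    have g_int: "integrable M (\<lambda>\<omega>. indicat_real B \<omega> *\<^sub>R g \<omega>)"
      using g(1) B by (rule integrable_mult_indicator[rotated])
    have le: "AE \<omega> in M. indicat_real B \<omega> *\<^sub>R g \<omega>
        \<le> indicat_real B \<omega> *\<^sub>R stopped_process Z (\<tau> (j + i)) t \<omega>" for j
      using g(2) by eventually_elim
        (auto simp: indicator_def intro: stopped_process_lower_bound[OF _ t])
    have conv: "AE \<omega> in M. (\<lambda>j. indicat_real B \<omega> *\<^sub>R stopped_process Z (\<tau> (j + i)) t \<omega>)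
        \<longlonglongrightarrow> indicat_real B \<omega> *\<^sub>R Z t \<omega>"
      using lim[OF t]
      by eventually_elim (intro tendsto_intros LIMSEQ_ignore_initial_segment)
    have m: "(\<lambda>\<omega>. indicat_real B \<omega> *\<^sub>R Z t \<omega>) \<in> borel_measurable M"
      using meas[OF t] B by simp
    note * = integral_le_of_bounded_below_limit[OF int g_int le conv m
        C[unfolded set_lebesgue_integral_def]]
    show "integrable M (\<lambda>\<omega>. indicator B \<omega> *\<^sub>R Z t \<omega>)" "(\<integral>\<omega>\<in>B. Z t \<omega> \<partial>M) \<le> C"
      using * by (simp_all add: set_lebesgue_integral_def)
  qed
  have Z_int: "integrable M (Z t)" if t: "0 \<le> t" for t
  proof -
    have sp: "space M \<in> sets (F 0)"
      using sub[of 0] by (metis order.refl sets.top subalgebra_def)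
    \<comment> \<open>At time 0 no stopping has any effect, so comparing times 0 and
      \<open>t\<close> on the whole space bounds all the integrals by the same constant.\<close>
    have "(\<integral>\<omega>\<in>space M. stopped_process Z (\<tau> (j + 0)) t \<omega> \<partial>M) \<le> (\<integral>\<omega>\<in>space M. Z 0 \<omega> \<partial>M)" for j
      using supermartingale_set_integral_mono[OF filt super order.refl t sp, of j]
      by (simp add: stopped_process_before)
    from fatou(1)[OF t sets.top this] show ?thesis
      by (simp cong: Bochner_Integration.integrable_cong)
  qed
  have "AE \<omega> in M. real_cond_exp M (F s) (Z t) \<omega> \<le> Z s \<omega>" if st: "0 \<le> s" "s \<le> t" for s t
  proof -
    interpret finite_measure_subalgebra M "F s"
      using filt st(1) by (rule filtered_prob_space_finite_measure_subalgebra)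
    let ?E = "real_cond_exp M (F s) (Z t)"
    have t: "0 \<le> t"
      using st by simp
    have space_F: "space (F s) = space M"
      using sub[OF st(1)] by (simp add: subalgebra_def)
    have [measurable]: "Z s \<in> borel_measurable (F s)" "?E \<in> borel_measurable (F s)"
      using adapted st(1) by (auto simp: adapted_def)
    \<comment> \<open>\<open>D\<close> is where the supermartingale inequality fails; the aim is to
      show that it is a null set.\<close>
    define D where "D = {\<omega> \<in> space M. Z s \<omega> < ?E \<omega>}"
    have D: "D \<in> sets (F s)"
      unfolding D_def space_F[symmetric] by measurable
    have not_in: "AE \<omega> in M. \<not> (\<omega> \<in> D \<and> ennreal s < \<tau> i \<omega>)" for i
    proof -
      \<comment> \<open>\<open>B\<close> is the part of \<open>D\<close> with
        \<open>s < \<tau> i\<close>. It stays in \<open>F s\<close> because the removed set is an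
        event of \<open>F s\<close> by the stopping time property.\<close>
      define B where "B = D - {\<omega> \<in> space M. \<tau> i \<omega> \<le> ennreal s}"
      have B: "B \<in> sets (F s)"
        using D stop[of i] st(1) by (auto simp: B_def extended_stopping_time_def)
      have BM: "B \<in> sets M"
        using B sub[OF st(1)] by (auto simp: subalgebra_def)
      \<comment> \<open>On \<open>B\<close> monotonicity gives
        \<open>s < \<tau> i \<le> \<tau> (j + i)\<close>, so none of these times has stopped the
        path by time \<open>s\<close>. This makes the upper bound in the next step independent of
        \<open>j\<close>.\<close>
      have frozen: "AE \<omega> in M. \<omega> \<in> B \<longrightarrow> stopped_process Z (\<tau> (j + i)) s \<omega> = Z s \<omega>" for j
        using \<tau> AE_space
      proof eventually_elim
        case (elim \<omega>)
        then have "\<tau> i \<omega> \<le> \<tau> (j + i) \<omega>"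
          by (auto simp: incseq_def)
        then show ?case
          using elim st(1) by (auto simp: B_def not_le intro!: stopped_process_before)
      qed
      have "(\<integral>\<omega>\<in>B. stopped_process Z (\<tau> (j + i)) t \<omega> \<partial>M) \<le> (\<integral>\<omega>\<in>B. Z s \<omega> \<partial>M)" for j
      proof -
        have "(\<integral>\<omega>\<in>B. stopped_process Z (\<tau> (j + i)) t \<omega> \<partial>M)
            \<le> (\<integral>\<omega>\<in>B. stopped_process Z (\<tau> (j + i)) s \<omega> \<partial>M)"
          by (rule supermartingale_set_integral_mono[OF filt super st B])
        also have "\<dots> = (\<integral>\<omega>\<in>B. Z s \<omega> \<partial>M)"
          using super[of "j + i"] st(1) meas[OF st(1)] BM frozen[of j]
          by (intro set_lebesgue_integral_cong_AE) (auto simp: supermartingale_def)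
        finally show ?thesis .
      qed
      then have "(\<integral>\<omega>\<in>B. Z t \<omega> \<partial>M) \<le> (\<integral>\<omega>\<in>B. Z s \<omega> \<partial>M)"
        by (rule fatou(2)[OF t BM])
      then have le: "(\<integral>\<omega>\<in>B. ?E \<omega> \<partial>M) \<le> (\<integral>\<omega>\<in>B. Z s \<omega> \<partial>M)"
        using real_cond_exp_intA[OF Z_int[OF t] B] by simp
      \<comment> \<open>\<open>?d\<close> is strictly positive on \<open>B\<close> and zero off it,
        while \<open>le\<close> makes its integral at most 0. Hence \<open>?d\<close> vanishes
        almost everywhere, which forces \<open>B\<close> to be null.\<close>
      let ?d = "\<lambda>\<omega>. indicat_real B \<omega> *\<^sub>R ?E \<omega> - indicat_real B \<omega> *\<^sub>R Z s \<omega>"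
      have ints: "integrable M (\<lambda>\<omega>. indicat_real B \<omega> *\<^sub>R ?E \<omega>)"
        "integrable M (\<lambda>\<omega>. indicat_real B \<omega> *\<^sub>R Z s \<omega>)"
        by (rule integrable_mult_indicator[OF BM real_cond_exp_int(1)[OF Z_int[OF t]]])
          (rule integrable_mult_indicator[OF BM Z_int[OF st(1)]])
      have nonneg: "AE \<omega> in M. 0 \<le> ?d \<omega>"
        by (auto simp: indicator_def B_def D_def)
      have "integral\<^sup>L M ?d \<le> 0"
        using le ints by (simp add: set_lebesgue_integral_def)
      then have "integral\<^sup>L M ?d = 0"
        using integral_nonneg_AE[OF nonneg] by simp
      then have "AE \<omega> in M. ?d \<omega> = 0"
        using integral_nonneg_eq_0_iff_AE[OF _ nonneg] ints by simp
      with AE_space show ?thesis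
        by eventually_elim (auto simp: indicator_def B_def D_def split: if_splits)
    qed
    \<comment> \<open>Almost every point satisfies \<open>s < \<tau> i\<close> for some
      \<open>i\<close>, so up to a null set \<open>D\<close> is a countable union of null
      sets.\<close>
    then have "AE \<omega> in M. \<forall>i. \<not> (\<omega> \<in> D \<and> ennreal s < \<tau> i \<omega>)"
      by (subst AE_all_countable) blast
    with \<tau>_large[of s] AE_space show ?thesis
    proof eventually_elim
      case (elim \<omega>)
      then obtain i where "ennreal s < \<tau> i \<omega>"
        by (auto simp: eventually_sequentially)
      with elim have "\<omega> \<notin> D"
        by blast
      with elim show ?case
        by (simp add: D_def)
    qed
  qed
  then show ?thesis
    using adapted Z_int by (simp add: supermartingale_def)
qed

section \<open>Measurability and size of the integrated supply rate\<close>

text \<open>Sampling the path on a time grid involves only countably many of the measurable maps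
  \<open>X t\<close>, and path continuity gives pointwise convergence as the mesh shrinks. The clamp
  \<open>max 0 s\<close> extends the process to all real times while evaluating it only where the
  assumptions apply.\<close>

lemma joint_measurable_continuous_paths:
  fixes X :: "real \<Rightarrow> 'a \<Rightarrow> 'b::metric_space"
  assumes meas: "\<And>t. 0 \<le> t \<Longrightarrow> X t \<in> borel_measurable M" and cont: "continuous_paths M X"
  shows "(\<lambda>(s, \<omega>). X (max 0 s) \<omega>) \<in> borel_measurable (borel \<Otimes>\<^sub>M M)"
proof (rule borel_measurable_LIMSEQ_metric)
  \<comment> \<open>\<open>?q n s\<close> is the largest multiple of \<open>1 / (n + 1)\<close> that
    does not exceed \<open>max 0 s\<close>.\<close>
  let ?q = "\<lambda>n s. real (nat \<lfloor>real (Suc n) * max 0 s\<rfloor>) / real (Suc n)"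
  show "(\<lambda>p. X (?q n (fst p)) (snd p)) \<in> borel_measurable (borel \<Otimes>\<^sub>M M)" for n
  proof (rule measurable_compose_countable
      [where f="\<lambda>k p. X (real k / real (Suc n)) (snd p)"])
    show "(\<lambda>p. X (real k / real (Suc n)) (snd p)) \<in> borel_measurable (borel \<Otimes>\<^sub>M M)" for k
      by (rule measurable_compose[OF measurable_snd meas]) simp
    show "(\<lambda>p. nat \<lfloor>real (Suc n) * max 0 (fst p)\<rfloor>)
        \<in> measurable (borel \<Otimes>\<^sub>M M) (count_space UNIV)"
      by measurable
  qed
  fix p :: "real \<times> 'a"
  assume p: "p \<in> space (borel \<Otimes>\<^sub>M M)"
  obtain s \<omega> where [simp]: "p = (s, \<omega>)"
    by (cases p)
  have \<omega>: "\<omega> \<in> space M"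
    using p by (simp add: space_pair_measure)
  define r where "r = max 0 s"
  have r: "0 \<le> r"
    by (simp add: r_def)
  have "(\<lambda>n. ?q n s) \<longlonglongrightarrow> r"
  proof (rule tendsto_sandwich)
    show "\<forall>\<^sub>F n in sequentially. r - 1 / real (Suc n) \<le> ?q n s"
    proof (rule always_eventually, intro allI)
      fix n
      have "real (Suc n) * r - 1 \<le> real (nat \<lfloor>real (Suc n) * r\<rfloor>)"
        by linarith
      then have "(real (Suc n) * r - 1) / real (Suc n) \<le> ?q n s"
        unfolding r_def[symmetric] by (intro divide_right_mono) auto
      then show "r - 1 / real (Suc n) \<le> ?q n s"
        by (simp add: diff_divide_distrib del: of_nat_Suc)
    qed
    show "\<forall>\<^sub>F n in sequentially. ?q n s \<le> r"
    proof (rule always_eventually, intro allI)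
      fix n
      have "0 \<le> real (Suc n) * r"
        using r by simp
      then have "real (nat \<lfloor>real (Suc n) * r\<rfloor>) \<le> real (Suc n) * r"
        by linarith
      then show "?q n s \<le> r"
        by (simp add: r_def[symmetric] divide_le_eq mult.commute del: of_nat_Suc)
    qed
    have "(\<lambda>n. r - 1 / real (Suc n)) \<longlonglongrightarrow> r - 0"
      by (intro tendsto_diff tendsto_const LIMSEQ_Suc lim_1_over_n)
    then show "(\<lambda>n. r - 1 / real (Suc n)) \<longlonglongrightarrow> r"
      by simp
  qed simp
  moreover have "continuous_on {0..} (\<lambda>t. X t \<omega>)"
    using cont \<omega> by (simp add: continuous_paths_def)
  ultimately have "(\<lambda>n. X (?q n s) \<omega>) \<longlonglongrightarrow> X r \<omega>"
    using r by (intro continuous_on_tendsto_compose[where f="\<lambda>t. X t \<omega>" and s="{0..}"]) auto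
  then show "(\<lambda>n. X (?q n (fst p)) (snd p)) \<longlonglongrightarrow> (case p of (s, \<omega>) \<Rightarrow> X (max 0 s) \<omega>)"
    by (simp add: r_def)
qed

text \<open>Clamping time to \<open>{0..t}\<close> is a measurable map into the domain on which
  progressive measurability speaks, so composing with it yields measurability for all real
  times.\<close>

lemma joint_measurable_progressively_measurable:
  assumes u: "progressively_measurable F u" and sub: "subalgebra M (F t)" and t: "0 \<le> t"
  shows "(\<lambda>(s, \<omega>). u (max 0 (min s t)) \<omega>) \<in> borel_measurable (borel \<Otimes>\<^sub>M M)"
proof -
  have "(\<lambda>(s, \<omega>). u s \<omega>) \<in> borel_measurable (restrict_space borel {0..t} \<Otimes>\<^sub>M F t)"
    using u t by (simp add: progressively_measurable_def)
  moreover have "(\<lambda>p. (max 0 (min (fst p) t), snd p))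
      \<in> measurable (borel \<Otimes>\<^sub>M M) (restrict_space borel {0..t} \<Otimes>\<^sub>M F t)"
  proof (rule measurable_Pair)
    show "(\<lambda>p. max 0 (min (fst p) t)) \<in> measurable (borel \<Otimes>\<^sub>M M) (restrict_space borel {0..t})"
      using t by (intro measurable_restrict_space2) auto
    show "snd \<in> measurable (borel \<Otimes>\<^sub>M M) (F t)"
      using measurable_comp[OF measurable_snd measurable_from_subalg[OF sub measurable_ident]]
      by (simp add: comp_def id_def)
  qed
  ultimately show ?thesis
    using measurable_comp by (fastforce simp: comp_def case_prod_beta)
qed

text \<open>The clamped integrand is jointly measurable, and integrating out time preserves
  measurability in the sample point by Tonelli. Clamping is harmless because the integral only sees
  times in \<open>{0..t}\<close>.\<close>

lemma nn_integral_supply_measurable: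
  fixes f :: "(real ^ 'd) \<times> (real ^ 'n) \<Rightarrow> real ^ 'n"
  assumes filt: "filtered_prob_space M F" and u: "progressively_measurable F u"
    and X: "adapted F X" "continuous_paths M X" and f: "f \<in> borel_measurable borel"
    and t: "0 \<le> t"
  shows "(\<lambda>\<omega>. \<integral>\<^sup>+s\<in>{0..t}. ennreal \<bar>u s \<omega> \<bullet> system_output f X u s \<omega>\<bar> \<partial>lborel)
    \<in> borel_measurable M"
proof -
  have sub: "subalgebra M (F s)" if "0 \<le> s" for s
    using filt that by (simp add: filtered_prob_space_def)
  have X_meas: "X s \<in> borel_measurable M" if "0 \<le> s" for s
    using X(1) measurable_from_subalg[OF sub] that by (auto simp: adapted_def)
  have [measurable]: "(\<lambda>p. X (max 0 (snd p)) (fst p)) \<in> borel_measurable (M \<Otimes>\<^sub>M borel)"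
    using measurable_compose[OF measurable_pair_swap'
        joint_measurable_continuous_paths[OF X_meas X(2)]]
    by (simp add: case_prod_beta)
  have [measurable]: "(\<lambda>p. u (max 0 (min (snd p) t)) (fst p)) \<in> borel_measurable (M \<Otimes>\<^sub>M borel)"
    using measurable_compose[OF measurable_pair_swap'
        joint_measurable_progressively_measurable[OF u sub[OF t] t]]
    by (simp add: case_prod_beta)
  note [measurable] = f
  have f_meas: "(\<lambda>p. f (X (max 0 (snd p)) (fst p), u (max 0 (min (snd p) t)) (fst p)))
      \<in> borel_measurable (M \<Otimes>\<^sub>M borel)"
    by (rule measurable_compose[OF _ f]) (simp add: borel_prod[symmetric])
  have "(\<lambda>p. ennreal \<bar>u (max 0 (min (snd p) t)) (fst p) \<bullet>
        f (X (max 0 (snd p)) (fst p), u (max 0 (min (snd p) t)) (fst p))\<bar> *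
        indicator {0..t} (snd p)) \<in> borel_measurable (M \<Otimes>\<^sub>M lborel)"
    using f_meas by measurable
  then have "(\<lambda>\<omega>. \<integral>\<^sup>+s. ennreal \<bar>u (max 0 (min s t)) \<omega> \<bullet>
        f (X (max 0 s) \<omega>, u (max 0 (min s t)) \<omega>)\<bar> * indicator {0..t} s \<partial>lborel)
      \<in> borel_measurable M"
    by (intro lborel.borel_measurable_nn_integral) (simp add: case_prod_beta)
  moreover have "(\<integral>\<^sup>+s. ennreal \<bar>u (max 0 (min s t)) \<omega> \<bullet>
        f (X (max 0 s) \<omega>, u (max 0 (min s t)) \<omega>)\<bar> * indicator {0..t} s \<partial>lborel)
      = (\<integral>\<^sup>+s\<in>{0..t}. ennreal \<bar>u s \<omega> \<bullet> system_output f X u s \<omega>\<bar> \<partial>lborel)" for \<omega>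
    by (intro nn_integral_cong) (auto simp: indicator_def system_output_def)
  ultimately show ?thesis
    by simp
qed

text \<open>
  If the path is not integrable on \<open>{0..s}\<close>, the left-hand side is the junk value \<open>0\<close> and the
  inequality still holds.
\<close>

lemma set_integral_le_enn2real_nn_integral:
  fixes h :: "real \<Rightarrow> real"
  assumes fin: "(\<integral>\<^sup>+r\<in>{0..t}. ennreal \<bar>h r\<bar> \<partial>lborel) < \<infinity>" and s: "s \<le> t"
  shows "(LINT r:{0..s}|lborel. h r) \<le> enn2real (\<integral>\<^sup>+r\<in>{0..t}. ennreal \<bar>h r\<bar> \<partial>lborel)"
proof (cases "set_integrable lborel {0..s} h")
  case True
  have "ennreal \<bar>LINT r:{0..s}|lborel. h r\<bar> \<le> (\<integral>\<^sup>+r. ennreal (norm (indicat_real {0..s} r *\<^sub>R h r)) \<partial>lborel)"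
    using integral_norm_bound_ennreal True
    unfolding set_lebesgue_integral_def set_integrable_def by fastforce
  also have "\<dots> \<le> (\<integral>\<^sup>+r\<in>{0..t}. ennreal \<bar>h r\<bar> \<partial>lborel)"
    using s by (intro nn_integral_mono) (auto simp: indicator_def)
  \<comment> \<open>Finiteness matters here: \<open>enn2real\<close> sends infinity to 0 and is
    monotone only below a finite bound.\<close>
  finally have "\<bar>LINT r:{0..s}|lborel. h r\<bar> \<le> enn2real (\<integral>\<^sup>+r\<in>{0..t}. ennreal \<bar>h r\<bar> \<partial>lborel)"
    using fin by (metis abs_ge_zero enn2real_ennreal enn2real_mono infinity_ennreal_def)
  then show ?thesis
    by simp
next
  case False
  then show ?thesis
    by (simp add: set_lebesgue_integral_def set_integrable_def not_integrable_integral_eq)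
qed

section \<open>Application to the passivity process\<close>

theorem proposition4p3:
  fixes M :: "'a measure"
    and F :: "real \<Rightarrow> 'a measure"
    and W :: "real \<Rightarrow> 'a \<Rightarrow> real ^ 'k"
    and A :: "(real \<Rightarrow> 'a \<Rightarrow> real ^ 'n) set"
    and b :: "(real ^ 'd) \<times> (real ^ 'n) \<Rightarrow> real ^ 'd"
    and \<sigma> :: "(real ^ 'd) \<times> (real ^ 'n) \<Rightarrow> real ^ 'k ^ 'd"
    and f :: "(real ^ 'd) \<times> (real ^ 'n) \<Rightarrow> real ^ 'n"
    and H :: "real ^ 'd \<Rightarrow> real"
  assumes "filtered_prob_space M F"
    and "usual_conditions M F"
    and "wiener_process M F W"
    and "\<And>u. u \<in> A \<Longrightarrow> progressively_measurable F u"
    and "b \<in> borel_measurable borel"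
    and "\<sigma> \<in> borel_measurable borel"
    and "f \<in> borel_measurable borel"
    and "H \<in> borel_measurable borel"
    and "existence_and_uniqueness M F W A b \<sigma>"
    and "class_C2 H"
    and "passive_local_supermartingale_property M F W A b \<sigma> f H"
    and "bdd_below (range H)"
    and "\<And>x\<^sub>0 u t. u \<in> A \<Longrightarrow> t \<ge> 0 \<Longrightarrow>
           (let X = solution M F W b \<sigma> x\<^sub>0 u; Y = system_output f X u in
             (\<integral>\<^sup>+\<omega>. (\<integral>\<^sup>+s\<in>{0..t}. ennreal \<bar>u s \<omega> \<bullet> Y s \<omega>\<bar> \<partial>lborel) \<partial>M) < \<infinity>)"
  shows "passive_supermartingale_property M F W A b \<sigma> f H"
  unfolding passive_supermartingale_property_def Let_def
proof (intro allI ballI)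
  fix x\<^sub>0 u
  assume u: "u \<in> A"
  define X where "X = solution M F W b \<sigma> x\<^sub>0 u"
  let ?Y = "system_output f X u"
  let ?V = "\<lambda>t \<omega>. \<integral>\<^sup>+s\<in>{0..t}. ennreal \<bar>u s \<omega> \<bullet> ?Y s \<omega>\<bar> \<partial>lborel"
  interpret prob_space M
    using assms(1) by (simp add: filtered_prob_space_def)
  \<comment> \<open>\<open>solution\<close> is defined by choice; the existence assumption ensures
    that the chosen process is a strong solution.\<close>
  have "strong_solution M F W b \<sigma> x\<^sub>0 u X"
    using assms(9) u someI_ex[of "strong_solution M F W b \<sigma> x\<^sub>0 u"]
    unfolding existence_and_uniqueness_def X_def solution_def by blast
  then have X: "adapted F X" "continuous_paths M X"
    by (auto simp: strong_solution_def)
  obtain c where c: "\<And>x. c \<le> H x"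
    using assms(12) by (auto simp: bdd_below_def)
  have "supermartingale M F (passivity_process H X u ?Y)"
  proof (rule local_supermartingale_bounded_below_imp_supermartingale[OF assms(1)])
    show "local_supermartingale M F (passivity_process H X u ?Y)"
      using assms(11) u
      by (auto simp: passive_local_supermartingale_property_def Let_def X_def)
    fix t :: real
    assume t: "0 \<le> t"
    have V_meas: "?V t \<in> borel_measurable M"
      by (rule nn_integral_supply_measurable[OF assms(1) assms(4)[OF u] X assms(7) t])
    have V_fin: "(\<integral>\<^sup>+\<omega>. ?V t \<omega> \<partial>M) < \<infinity>"
      using assms(13)[OF u t, of x\<^sub>0] by (simp add: Let_def X_def)
    have V_AE: "AE \<omega> in M. ?V t \<omega> < \<infinity>"
      using nn_integral_PInf_AE[OF V_meas] V_fin by (simp add: less_top)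
    \<comment> \<open>The two integrands may differ where \<open>?V t\<close> is infinite, since
      \<open>enn2real\<close> gives 0 there, but this happens only on a null set.\<close>
    have "(\<integral>\<^sup>+\<omega>. ennreal (enn2real (?V t \<omega>)) \<partial>M) = (\<integral>\<^sup>+\<omega>. ?V t \<omega> \<partial>M)"
      using V_AE by (intro nn_integral_cong_AE) (auto elim!: eventually_mono)
    then have "integrable M (\<lambda>\<omega>. enn2real (?V t \<omega>))"
      using V_fin V_meas by (intro integrableI_nonneg) auto
    then have "integrable M (\<lambda>\<omega>. c - enn2real (?V t \<omega>))"
      by simp
    \<comment> \<open>The single exceptional set is where \<open>?V t\<close> is infinite. Off it,
      the supply integral up to any \<open>s \<le> t\<close> is at most \<open>?V t\<close>, while
      \<open>H\<close> is at least \<open>c\<close>.\<close>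
    moreover have "AE \<omega> in M. \<forall>s\<in>{0..t}.
        c - enn2real (?V t \<omega>) \<le> passivity_process H X u ?Y s \<omega>"
      using V_AE
    proof eventually_elim
      case (elim \<omega>)
      show ?case
      proof
        fix s
        assume "s \<in> {0..t}"
        then have "(LINT r:{0..s}|lborel. u r \<omega> \<bullet> ?Y r \<omega>) \<le> enn2real (?V t \<omega>)"
          using elim by (intro set_integral_le_enn2real_nn_integral) auto
        then show "c - enn2real (?V t \<omega>) \<le> passivity_process H X u ?Y s \<omega>"
          using c[of "X s \<omega>"] by (simp add: passivity_process_def)
      qed
    qed
    ultimately show "\<exists>g. integrable M g \<and>
        (AE \<omega> in M. \<forall>s\<in>{0..t}. g \<omega> \<le> passivity_process H X u ?Y s \<omega>)"
      by blast
  qed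
  then show "supermartingale M F (passivity_process H (solution M F W b \<sigma> x\<^sub>0 u) u
      (system_output f (solution M F W b \<sigma> x\<^sub>0 u) u))"
    by (simp add: X_def)
qed

end
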